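(* Let $(X_k)_k$ be a sequence of i.i.d. symmetric real random variables with the same law as $X$, where $\mathbb{E}(X)=0$, $\mathbb{E}(X^2)=1$ and $\mathbb{E}(X^4)<3$. Set $$Z_n:=\frac1{n^{1/4}}\sum_{k=1}^nX_k,\quad \gamma_n:=n^{1/4},\quad C:=\frac{3-\mathbb{E}(X^4)}6,\quad c_1:=\sqrt{2\pi}\,\mathbb{E}(e^{-CG^4/4}),\ G\sim\mathcal{N}(0,1),$$ and let $H_n\sim\mathscr{H}(\Phi_C,\gamma_n)$. Then $$d_{\mathrm{Kol}}(Z_n,H_n):=\sup_{x\in\mathbb{R}}\big|\mathbb{P}(Z_n\leq x)-\mathbb{P}(H_n\leq x)\big|\leq\frac{2(3+2C)^{1/3}(2-3C)^{1/3}}{c_1^{2/3}\,\gamma_n^{4/3}}+O\Big(\frac1{\gamma_n^{8/3}}\Big)$$ as $n\to\infty$.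
   Context: $X$ symmetric means that $X$ and $-X$ have the same law. With $\Phi_C(x):=e^{-Cx^4/4}$ and $\gamma>0$, $\mathscr{H}(\Phi_C,\gamma)$ is the probability distribution on $\mathbb{R}$ with density proportional to $\Phi_C(x/\gamma^2)e^{-x^2/(2\gamma^2)}=\exp\big(-\frac{x^2}{2\gamma^2}-\frac{C}{\gamma^8}\frac{x^4}4\big)$. *)

theory Defs
  imports "HOL-Probability.Probability"
begin

definition symmetric_rv :: "'a measure \<Rightarrow> ('a \<Rightarrow> real) \<Rightarrow> bool" where
  "symmetric_rv M X \<longleftrightarrow> distr M borel X = distr M borel (\<lambda>\<omega>. - X \<omega>)"

definition Phi :: "real \<Rightarrow> real \<Rightarrow> real" where
  "Phi C x = exp (- C * x ^ 4 / 4)"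

(* The normalising constant is the Lebesgue integral of the unnormalised density; the result is
   a probability measure whenever that density is nonnegative with positive finite integral. *)
definition penalised_gaussian :: "(real \<Rightarrow> real) \<Rightarrow> real \<Rightarrow> real measure" where
  "penalised_gaussian \<Phi> \<gamma> =
     (let f = (\<lambda>x. \<Phi> (x / \<gamma>\<^sup>2) * exp (- (x\<^sup>2 / (2 * \<gamma>\<^sup>2))))
      in density lborel (\<lambda>x. ennreal (f x / (LINT y|lborel. f y))))"

(* The two random variables may live on different probability spaces. *)
definition d_Kol :: "'a measure \<Rightarrow> ('a \<Rightarrow> real) \<Rightarrow> 'b measure \<Rightarrow> ('b \<Rightarrow> real) \<Rightarrow> real" where
  "d_Kol M Y N W = (SUP x::real. \<bar>\<P>(\<omega> in M. Y \<omega> \<le> x) - \<P>(\<omega> in N. W \<omega> \<le> x)\<bar>)"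

end

theory Submission
  imports Defs
begin

text \<open>The main term of the bound is a positive multiple of \<open>n powr (-1/3)\<close>, so any rate of convergence
  better than \<open>n powr (-1/3)\<close> makes the remainder vanish for all large n. Such a rate, \<open>n powr (-2/5)\<close>,
  comes from comparing both laws with the Gaussian of variance \<open>\<gamma>\<^sub>n\<^sup>2\<close>. For \<open>H\<^sub>n\<close> the densities differ by
  a relative error of order 1/n. For \<open>Z\<^sub>n\<close>, smooth by an independent Gaussian of standard deviation
  \<open>\<epsilon> = n powr (-2/5)\<close>: then Levy inversion bounds the smoothed distance by an integral over the
  characteristic functions, whose range \<open>\<bar>t\<bar> \<le> \<delta> sqrt n\<close> contributes \<open>O(1 / sqrt n)\<close> by a Taylor
  expansion and whose tail is killed by the Gaussian factor. Removing the smoothing costs \<open>O(\<epsilon>)\<close>.\<close>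

section \<open>Smoothing a law by an independent Gaussian\<close>

text \<open>Convolution with the normal law of variance \<open>\<epsilon>\<^sup>2\<close>, written
  on a product space so that its distribution function, atoms and characteristic function all follow
  from Fubini's theorem.\<close>

definition gauss_smooth :: "real \<Rightarrow> real measure \<Rightarrow> real measure" where
  "gauss_smooth \<epsilon> M = distr (M \<Otimes>\<^sub>M std_normal_distribution) borel (\<lambda>p. fst p + \<epsilon> * snd p)"

lemma pair_prob_space_std_normal:
  assumes "real_distribution M"
  shows "pair_prob_space M std_normal_distribution"
proof -
  interpret M: real_distribution M by fact
  interpret G: real_distribution std_normal_distribution by (rule real_dist_normal_dist)
  show ?thesis by unfold_locales
qed

lemma real_distribution_gauss_smooth:
  assumes "real_distribution M"
  shows "real_distribution (gauss_smooth \<epsilon> M)"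
proof -
  interpret M: real_distribution M by fact
  interpret P: pair_prob_space M std_normal_distribution
    by (rule pair_prob_space_std_normal) fact
  show ?thesis unfolding gauss_smooth_def by (rule P.real_distribution_distr) measurable
qed

lemma cdf_gauss_smooth:
  assumes "real_distribution M"
  shows "cdf (gauss_smooth \<epsilon> M) a = (LINT g|std_normal_distribution. cdf M (a - \<epsilon> * g))"
proof -
  interpret M: real_distribution M by fact
  interpret P: pair_prob_space M std_normal_distribution
    by (rule pair_prob_space_std_normal) fact
  let ?A = "{p \<in> space (M \<Otimes>\<^sub>M std_normal_distribution). fst p + \<epsilon> * snd p \<le> a}"
  have A [measurable]: "?A \<in> sets (M \<Otimes>\<^sub>M std_normal_distribution)" by measurable
  have "cdf (gauss_smooth \<epsilon> M) a = measure (M \<Otimes>\<^sub>M std_normal_distribution) ?A"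
    unfolding cdf_def gauss_smooth_def
    by (subst measure_distr) (simp_all add: vimage_def Int_def conj_commute)
  also have "\<dots> = (LINT p|(M \<Otimes>\<^sub>M std_normal_distribution). indicator ?A p)"
    by (simp add: Int_absorb2[OF sets.sets_into_space[OF A]])
  also have "\<dots> = (LINT g|std_normal_distribution. LINT x|M. indicator ?A (x, g))"
    using P.integral_snd[of "\<lambda>x g. indicator ?A (x, g) :: real"] A
    by (simp add: P.P.emeasure_finite less_top[symmetric])
  also have "\<dots> = (LINT g|std_normal_distribution. cdf M (a - \<epsilon> * g))"
  proof (rule Bochner_Integration.integral_cong[OF refl])
    fix g
    have "(LINT x|M. indicator ?A (x, g)) = (LINT x|M. indicator {..a - \<epsilon> * g} x :: real)"
      by (intro Bochner_Integration.integral_cong) (auto simp: space_pair_measure indicator_def)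
    then show "(LINT x|M. indicator ?A (x, g) :: real) = cdf M (a - \<epsilon> * g)" by (simp add: cdf_def)
  qed
  finally show ?thesis .
qed

text \<open>For fixed x exactly one Gaussian value gives the sum \<open>a\<close>, and single points
  have normal measure zero. Levy inversion requires interval endpoints that are not atoms.\<close>

lemma gauss_smooth_no_atoms:
  assumes "real_distribution M" "\<epsilon> > 0"
  shows "measure (gauss_smooth \<epsilon> M) {a} = 0"
proof -
  interpret M: real_distribution M by fact
  interpret P: pair_prob_space M std_normal_distribution
    by (rule pair_prob_space_std_normal) fact
  let ?A = "{p \<in> space (M \<Otimes>\<^sub>M std_normal_distribution). fst p + \<epsilon> * snd p = a}"
  have A [measurable]: "?A \<in> sets (M \<Otimes>\<^sub>M std_normal_distribution)" by measurable
  have "emeasure (gauss_smooth \<epsilon> M) {a} = emeasure (M \<Otimes>\<^sub>M std_normal_distribution) ?A"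
    unfolding gauss_smooth_def
    by (subst emeasure_distr) (auto intro!: arg_cong2[where f=emeasure] simp: space_pair_measure)
  also have "\<dots> = (\<integral>\<^sup>+x. emeasure std_normal_distribution (Pair x -` ?A) \<partial>M)"
    by (rule P.M2.emeasure_pair_measure_alt[OF A])
  also have "\<dots> = (\<integral>\<^sup>+x. 0 \<partial>M)"
  proof (rule nn_integral_cong)
    fix x
    have eq: "Pair x -` ?A = {(a - x) / \<epsilon>}"
      using \<open>\<epsilon> > 0\<close> by (auto simp: space_pair_measure field_simps)
    show "emeasure std_normal_distribution (Pair x -` ?A) = 0"
      unfolding eq by (subst emeasure_density) (auto simp: nn_integral_0_iff_AE AE_lborel_singleton
        intro!: AE_I'[of "{(a - x) / \<epsilon>}"] split: split_indicator)
  qed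
  finally show ?thesis by (simp add: measure_def)
qed

lemma char_gauss_smooth:
  assumes "real_distribution M"
  shows "char (gauss_smooth \<epsilon> M) t = char M t * exp (- (\<epsilon> * t)\<^sup>2 / 2)"
proof -
  interpret M: real_distribution M by fact
  interpret P: pair_prob_space M std_normal_distribution
    by (rule pair_prob_space_std_normal) fact
  have int: "integrable (M \<Otimes>\<^sub>M std_normal_distribution) (\<lambda>(x, g). iexp (t * (x + \<epsilon> * g)))"
    by (rule P.integrable_const_bound[of _ 1])
      (auto simp: split_beta norm_exp_i_times simp del: of_real_mult of_real_add)
  have "char (gauss_smooth \<epsilon> M) t =
      (CLINT p|(M \<Otimes>\<^sub>M std_normal_distribution). iexp (t * (fst p + \<epsilon> * snd p)))"
    unfolding gauss_smooth_def char_def by (subst integral_distr) auto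
  also have "\<dots> = (CLINT x|M. CLINT g|std_normal_distribution. iexp (t * (x + \<epsilon> * g)))"
    by (subst P.integral_fst[OF int]) (simp only: case_prod_unfold)
  also have "\<dots> = (CLINT x|M. iexp (t * x) * char std_normal_distribution (\<epsilon> * t))"
    unfolding char_def integral_mult_right_zero[symmetric]
    by (intro Bochner_Integration.integral_cong) (auto simp: exp_add[symmetric] algebra_simps)
  also have "\<dots> = char M t * char std_normal_distribution (\<epsilon> * t)"
    by (simp add: char_def)
  finally show ?thesis by (simp add: char_std_normal_distribution)
qed

section \<open>Levy inversion: from characteristic to distribution functions\<close>

text \<open>The inversion kernel \<open>?F\<close> has modulus at most
  \<open>2 / \<bar>t\<bar>\<close>, and the factor \<open>\<bar>t\<bar>\<close> in the hypothesis on
  \<open>B\<close> cancels this singularity. Each truncated difference is therefore at most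
  \<open>2 / (2 * pi)\<close> times the integral of \<open>B\<close>; then \<open>T\<close> tends to
  infinity.\<close>

lemma measure_Ioc_diff_le_char:
  fixes M N :: "real measure" and B :: "real \<Rightarrow> real"
  assumes M: "real_distribution M" and N: "real_distribution N"
    and Ma: "\<And>x. measure M {x} = 0" and Na: "\<And>x. measure N {x} = 0"
    and B: "integrable lborel B" and B0: "\<And>t. B t \<ge> 0"
    and le: "\<And>t. cmod (char M t - char N t) \<le> \<bar>t\<bar> * B t"
    and ab: "a \<le> b"
  shows "\<bar>measure M {a<..b} - measure N {a<..b}\<bar> \<le> (LINT t|lborel. B t) / pi"
proof -
  interpret M: real_distribution M by fact
  interpret N: real_distribution N by fact
  let ?F = "\<lambda>t::real. (iexp (-(t * a)) - iexp (-(t * b))) / (\<i> * t)"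
  let ?I = "\<lambda>M (T::nat). 1 / (2 * pi) * (CLBINT t=-T..T. ?F t * char M t)"
  \<comment> \<open>This bound depends on the interval and serves integrability on bounded ranges;
    \<open>F_le'\<close> is uniform in \<open>a\<close> and \<open>b\<close>. At
    \<open>t = 0\<close> division by zero gives the kernel the value 0.\<close>
  have F_le: "cmod (?F t) \<le> b - a" for t :: real
  proof (cases "t = 0")
    case False
    then show ?thesis using Levy_Inversion_aux2[of "-b" "-a" t] ab by simp
  qed (use ab in simp)
  have F_le': "cmod (?F t) * \<bar>t\<bar> \<le> 2" for t :: real
  proof (cases "t = 0")
    case False
    have "cmod (iexp (-(t * a)) - iexp (-(t * b))) \<le> 1 + 1"
      by (rule order_trans[OF norm_triangle_ineq4])
        (simp add: norm_exp_i_times del: of_real_mult of_real_minus)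
    then show ?thesis using False by (simp add: norm_divide norm_mult)
  qed simp
  have int: "integrable lborel (\<lambda>t. indicator {-real T<..<T} t *\<^sub>R (?F t * char K t))"
    if K: "real_distribution K" for K and T :: nat
  proof -
    interpret K: real_distribution K by fact
    have 1: "integrable lborel (\<lambda>t. (b - a) * indicator {-real T<..<T} t)" by simp
    have 2: "cmod (?F t * char K t) \<le> b - a" for t
      using mult_mono[OF F_le[of t] K.cmod_char_le_1[of t]] ab
      by (simp only: norm_mult mult_1_right) simp
    have 3: "norm (indicator {-real T<..<T} t *\<^sub>R (?F t * char K t))
        \<le> norm ((b - a) * indicator {-real T<..<T} t)" for t
    proof (cases "t \<in> {-real T<..<T}")
      case True
      show ?thesis
        unfolding indicator_simps(1)[OF True] scaleR_one mult_1_right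
        using 2[of t] by (rule order_trans) simp
    qed simp
    show ?thesis
      by (rule Bochner_Integration.integrable_bound[OF 1]) (use 3 in auto)
  qed
  have scale: "cmod (1 / (2 * pi) * z) \<le> 1 / (2 * pi) * r" if "cmod z \<le> r" for z :: complex and r :: real
    using divide_right_mono[OF that, of "2 * pi"] by (simp add: norm_divide norm_mult)
  have diff_le: "cmod (?I M T - ?I N T) \<le> (LINT t|lborel. B t) / pi" for T
  proof -
    have I: "?I K T = 1 / (2 * pi) * (CLINT t|lborel. indicator {-real T<..<T} t *\<^sub>R (?F t * char K t))" for K
      by (simp add: interval_lebesgue_integral_def set_lebesgue_integral_def)
    have "?I M T - ?I N T = 1 / (2 * pi) *
       (CLINT t|lborel. indicator {-real T<..<T} t *\<^sub>R (?F t * (char M t - char N t)))"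
      unfolding I right_diff_distrib[symmetric]
      by (subst Bochner_Integration.integral_diff[symmetric, OF int[OF M] int[OF N]])
        (simp only: right_diff_distrib scaleR_right_diff_distrib)
    also have "cmod \<dots> \<le> 1 / (2 * pi) * (LINT t|lborel. 2 * B t)"
    proof -
      have "norm (indicator {-real T<..<T} t *\<^sub>R (?F t * (char M t - char N t))) \<le> 2 * B t" for t
      proof -
        have "norm (?F t * (char M t - char N t)) \<le> cmod (?F t) * (\<bar>t\<bar> * B t)"
          unfolding norm_mult by (rule mult_left_mono[OF le]) simp
        also have "\<dots> \<le> 2 * B t"
          using mult_right_mono[OF F_le' B0] by (simp add: mult.assoc)
        finally show ?thesis using B0[of t] by (auto split: split_indicator)
      qed
      then have "cmod (CLINT t|lborel. indicator {-real T<..<T} t *\<^sub>R (?F t * (char M t - char N t)))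
          \<le> (LINT t|lborel. 2 * B t)"
        using B B0 by (intro order_trans[OF integral_norm_bound] integral_mono') auto
      from scale[OF this] show ?thesis .
    qed
    finally show ?thesis by simp
  qed
  have "(\<lambda>T. cmod (?I M T - ?I N T)) \<longlonglongrightarrow> cmod (complex_of_real (measure M {a<..b}) - measure N {a<..b})"
    by (intro tendsto_intros M.Levy_Inversion N.Levy_Inversion ab Ma Na)
  then have "cmod (complex_of_real (measure M {a<..b}) - measure N {a<..b}) \<le> (LINT t|lborel. B t) / pi"
    by (rule LIMSEQ_le_const2) (use diff_le in auto)
  then show ?thesis by (simp flip: of_real_diff)
qed

text \<open>The bound for half-open intervals does not depend on the left endpoint, which is sent to
  minus infinity along \<open>- real n\<close>.\<close>

lemma cdf_diff_le_char:
  fixes M N :: "real measure" and B :: "real \<Rightarrow> real"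
  assumes M: "real_distribution M" and N: "real_distribution N"
    and Ma: "\<And>x. measure M {x} = 0" and Na: "\<And>x. measure N {x} = 0"
    and B: "integrable lborel B" and B0: "\<And>t. B t \<ge> 0"
    and le: "\<And>t. cmod (char M t - char N t) \<le> \<bar>t\<bar> * B t"
  shows "\<bar>cdf M x - cdf N x\<bar> \<le> (LINT t|lborel. B t) / pi"
proof -
  interpret M: real_distribution M by fact
  interpret N: real_distribution N by fact
  have "(\<lambda>n. \<bar>(cdf M x - cdf M (- real n)) - (cdf N x - cdf N (- real n))\<bar>)
      \<longlonglongrightarrow> \<bar>(cdf M x - 0) - (cdf N x - 0)\<bar>"
    by (intro tendsto_intros M.cdf_lim_neg_infty N.cdf_lim_neg_infty)
  moreover have "\<forall>\<^sub>F n in sequentially. \<bar>(cdf M x - cdf M (- real n)) - (cdf N x - cdf N (- real n))\<bar>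
      \<le> (LINT t|lborel. B t) / pi"
    using eventually_gt_at_top[of "nat \<lceil>-x\<rceil>"]
  proof eventually_elim
    case (elim n)
    then have "- real n < x" by linarith
    then show ?case
      using measure_Ioc_diff_le_char[OF assms, of "- real n" x]
      by (simp add: M.cdf_diff_eq N.cdf_diff_eq)
  qed
  ultimately show ?thesis
    using tendsto_upperbound[OF _ _ sequentially_bot] by fastforce
qed

section \<open>Removing the smoothing\<close>

lemma cdf_diff_abs_le_1:
  assumes "real_distribution M" "real_distribution N"
  shows "\<bar>cdf M x - cdf N x\<bar> \<le> 1"
proof -
  interpret M: real_distribution M by fact
  interpret N: real_distribution N by fact
  show ?thesis
    using M.cdf_nonneg[of x] N.cdf_nonneg[of x] M.cdf_bounded_prob[of x] N.cdf_bounded_prob[of x]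
    by linarith
qed

text \<open>At a point x where F exceeds G by d, monotonicity of F and the Lipschitz bound for G keep the
  difference above \<open>d - 4 L \<epsilon>\<close> on the interval \<open>[x, x + 4 \<epsilon>]\<close>, which carries most of the mass of the
  smoothing kernel centred at \<open>x + 2 \<epsilon>\<close>; elsewhere the Chebyshev-type bound
  \<open>1 \<le> g\<^sup>2 / 4\<close> pays for the worst case.\<close>

lemma cdf_desmoothing_pointwise:
  assumes M: "real_distribution M" and N: "real_distribution N"
    and L: "\<And>x y. x \<le> y \<Longrightarrow> cdf N y - cdf N x \<le> L * (y - x)" "L \<ge> 0"
    and \<epsilon>: "\<epsilon> \<ge> 0"
    and D: "\<And>x. \<bar>cdf M x - cdf N x\<bar> \<le> D"
    and \<eta>: "\<And>x. \<bar>cdf (gauss_smooth \<epsilon> M) x - cdf (gauss_smooth \<epsilon> N) x\<bar> \<le> \<eta>"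
  shows "\<bar>cdf M x - cdf N x\<bar> \<le> \<eta> + 4 * L * \<epsilon> + D / 2"
proof -
  interpret M: real_distribution M by fact
  interpret N: real_distribution N by fact
  interpret G: real_distribution std_normal_distribution by (rule real_dist_normal_dist)
  have cdf_borel [measurable]: "cdf M \<in> borel_measurable borel" "cdf N \<in> borel_measurable borel"
    by (auto intro!: borel_measurable_mono monoI M.cdf_nondecreasing N.cdf_nondecreasing)
  have G2: "integrable std_normal_distribution (\<lambda>g. g\<^sup>2)"
    "(LINT g|std_normal_distribution. g\<^sup>2) = 1"
    using integrable_std_normal_distribution_moment[of 2] std_normal_distribution_even_moments(1)[of 1]
    by simp_all
  have int: "integrable std_normal_distribution (\<lambda>g. cdf K (a - \<epsilon> * g))"
    if "real_distribution K" and [measurable]: "cdf K \<in> borel_measurable borel" for K a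
  proof -
    interpret K: real_distribution K by fact
    show ?thesis
      by (rule G.integrable_const_bound[of _ 1])
        (auto simp: K.cdf_nonneg K.cdf_bounded_prob)
  qed
  have smooth: "cdf (gauss_smooth \<epsilon> M) a - cdf (gauss_smooth \<epsilon> N) a
      = (LINT g|std_normal_distribution. cdf M (a - \<epsilon> * g) - cdf N (a - \<epsilon> * g))" for a
    unfolding cdf_gauss_smooth[OF M] cdf_gauss_smooth[OF N]
    by (rule Bochner_Integration.integral_diff[symmetric]) (auto intro!: int M N)
  have "D \<ge> 0" using D[of 0] by linarith
  have g2: "g\<^sup>2 \<ge> 4" if "\<bar>g\<bar> > 2" for g :: real
    using power_mono[of 2 "\<bar>g\<bar>" 2] that by simp
  \<comment> \<open>Far out the difference can fall from at most \<open>D\<close> to no less than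
    \<open>- D\<close>, a loss of at most \<open>2 * D\<close>. The weight charged for this has mean
    \<open>D / 2\<close>, because the second moment is 1.\<close>
  have far: "D * g\<^sup>2 / 2 \<ge> 2 * D" if "\<bar>g\<bar> > 2" for g
    using mult_left_mono[OF g2[OF that] \<open>D \<ge> 0\<close>] by simp
  have \<epsilon>g: "\<epsilon> * g \<le> 2 * \<epsilon>" "\<epsilon> * g \<ge> - 2 * \<epsilon>" if "\<bar>g\<bar> \<le> 2" for g
    using mult_left_mono[of g 2 \<epsilon>] mult_left_mono[of "-2" g \<epsilon>] \<epsilon> that by (auto simp: mult.commute abs_le_iff)
  have Lz: "L * z \<le> 4 * L * \<epsilon>" if "z \<le> 4 * \<epsilon>" for z
    using mult_left_mono[OF that L(2)] by simp
  have L\<epsilon>: "4 * L * \<epsilon> \<ge> 0" using L(2) \<epsilon> by simp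
  have Dg: "D * g\<^sup>2 / 2 \<ge> 0" for g using \<open>D \<ge> 0\<close> by simp
  have up: "cdf M x - cdf N x \<le> \<eta> + 4 * L * \<epsilon> + D / 2"
  proof -
    let ?d = "cdf M x - cdf N x"
    have pt: "?d - 4 * L * \<epsilon> - D * g\<^sup>2 / 2 \<le> cdf M (x + 2 * \<epsilon> - \<epsilon> * g) - cdf N (x + 2 * \<epsilon> - \<epsilon> * g)" for g
    proof (cases "\<bar>g\<bar> \<le> 2")
      case True
      define y where "y = x + 2 * \<epsilon> - \<epsilon> * g"
      have "x \<le> y" "y - x \<le> 4 * \<epsilon>" using \<epsilon>g[OF True] by (auto simp: y_def)
      then show ?thesis
        using M.cdf_nondecreasing[of x y] L(1)[of x y] Lz[of "y - x"] Dg[of g]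
        unfolding y_def[symmetric] by linarith
    next
      case False
      then show ?thesis
        using D[of x] D[of "x + 2 * \<epsilon> - \<epsilon> * g"] far[of g] L\<epsilon> by linarith
    qed
    have "(LINT g|std_normal_distribution. ?d - 4 * L * \<epsilon> - D * g\<^sup>2 / 2)
        \<le> cdf (gauss_smooth \<epsilon> M) (x + 2 * \<epsilon>) - cdf (gauss_smooth \<epsilon> N) (x + 2 * \<epsilon>)"
      unfolding smooth
      by (intro integral_mono pt Bochner_Integration.integrable_diff int M N cdf_borel) (auto intro!: G2)
    also have "(LINT g|std_normal_distribution. ?d - 4 * L * \<epsilon> - D * g\<^sup>2 / 2) = ?d - 4 * L * \<epsilon> - D / 2"
      using G2 G.prob_space by simp
    finally show ?thesis using \<eta>[of "x + 2 * \<epsilon>"] by linarith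
  qed
  have down: "cdf N x - cdf M x \<le> \<eta> + 4 * L * \<epsilon> + D / 2"
  proof -
    let ?d = "cdf M x - cdf N x"
    have pt: "cdf M (x - 2 * \<epsilon> - \<epsilon> * g) - cdf N (x - 2 * \<epsilon> - \<epsilon> * g) \<le> ?d + 4 * L * \<epsilon> + D * g\<^sup>2 / 2" for g
    proof (cases "\<bar>g\<bar> \<le> 2")
      case True
      define y where "y = x - 2 * \<epsilon> - \<epsilon> * g"
      have "y \<le> x" "x - y \<le> 4 * \<epsilon>" using \<epsilon>g[OF True] by (auto simp: y_def)
      then show ?thesis
        using M.cdf_nondecreasing[of y x] L(1)[of y x] Lz[of "x - y"] Dg[of g]
        unfolding y_def[symmetric] by linarith
    next
      case False
      then show ?thesis
        using D[of x] D[of "x - 2 * \<epsilon> - \<epsilon> * g"] far[of g] L\<epsilon> by linarith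
    qed
    have "cdf (gauss_smooth \<epsilon> M) (x - 2 * \<epsilon>) - cdf (gauss_smooth \<epsilon> N) (x - 2 * \<epsilon>)
        \<le> (LINT g|std_normal_distribution. ?d + 4 * L * \<epsilon> + D * g\<^sup>2 / 2)"
      unfolding smooth
      by (intro integral_mono pt Bochner_Integration.integrable_diff
          Bochner_Integration.integrable_add int M N cdf_borel) (auto intro!: G2)
    also have "(LINT g|std_normal_distribution. ?d + 4 * L * \<epsilon> + D * g\<^sup>2 / 2) = ?d + 4 * L * \<epsilon> + D / 2"
      using G2 G.prob_space by simp
    finally show ?thesis using \<eta>[of "x - 2 * \<epsilon>"] by linarith
  qed
  from up down show ?thesis by linarith
qed

text \<open>With the supremum \<open>D\<close> itself as the a priori bound, the pointwise estimate
  bounds \<open>D\<close> by a term containing \<open>D / 2\<close>, which can be absorbed because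
  \<open>D\<close> is finite.\<close>

lemma cdf_desmoothing:
  assumes M: "real_distribution M" and N: "real_distribution N"
    and L: "\<And>x y. x \<le> y \<Longrightarrow> cdf N y - cdf N x \<le> L * (y - x)" "L \<ge> 0"
    and \<epsilon>: "\<epsilon> \<ge> 0"
    and \<eta>: "\<And>x. \<bar>cdf (gauss_smooth \<epsilon> M) x - cdf (gauss_smooth \<epsilon> N) x\<bar> \<le> \<eta>"
  shows "\<bar>cdf M x - cdf N x\<bar> \<le> 2 * \<eta> + 8 * L * \<epsilon>"
proof -
  define D where "D = (SUP x. \<bar>cdf M x - cdf N x\<bar>)"
  have bdd: "bdd_above (range (\<lambda>x. \<bar>cdf M x - cdf N x\<bar>))"
    using cdf_diff_abs_le_1[OF M N] by (auto intro!: bdd_aboveI2)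
  have D: "\<bar>cdf M x - cdf N x\<bar> \<le> D" for x
    unfolding D_def by (rule cSUP_upper[OF _ bdd]) simp
  have "D \<le> \<eta> + 4 * L * \<epsilon> + D / 2"
    unfolding D_def
    by (rule cSUP_least) (auto intro!: cdf_desmoothing_pointwise[OF M N L \<epsilon> _ \<eta>] simp flip: D_def intro: D)
  with D[of x] show ?thesis by linarith
qed

text \<open>An Esseen-type inequality with a Gaussian kernel. \<open>M\<close> may have atoms, so
  inversion is applied to the smoothed laws, whose characteristic functions carry the Gaussian
  factor. The doubling in \<open>cdf_desmoothing\<close> produces \<open>2 / pi\<close> and
  8.\<close>

lemma smoothing_inequality:
  assumes M: "real_distribution M" and N: "real_distribution N"
    and L: "\<And>x y. x \<le> y \<Longrightarrow> cdf N y - cdf N x \<le> L * (y - x)" "L \<ge> 0"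
    and \<epsilon>: "\<epsilon> > 0"
    and B: "integrable lborel B" and B0: "\<And>t. B t \<ge> 0"
    and le: "\<And>t. cmod (char M t - char N t) * exp (- (\<epsilon> * t)\<^sup>2 / 2) \<le> \<bar>t\<bar> * B t"
  shows "\<bar>cdf M x - cdf N x\<bar> \<le> 2 / pi * (LINT t|lborel. B t) + 8 * L * \<epsilon>"
proof -
  have "\<bar>cdf (gauss_smooth \<epsilon> M) x - cdf (gauss_smooth \<epsilon> N) x\<bar> \<le> (LINT t|lborel. B t) / pi" for x
  proof (rule cdf_diff_le_char[OF _ _ _ _ B B0])
    fix t
    have "char (gauss_smooth \<epsilon> M) t - char (gauss_smooth \<epsilon> N) t
        = (char M t - char N t) * exp (- (\<epsilon> * t)\<^sup>2 / 2)"
      by (simp add: char_gauss_smooth M N algebra_simps)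
    then have "cmod (char (gauss_smooth \<epsilon> M) t - char (gauss_smooth \<epsilon> N) t)
        = cmod (char M t - char N t) * exp (- (\<epsilon> * t)\<^sup>2 / 2)"
      by (simp only: norm_mult norm_of_real abs_exp_cancel)
    then show "cmod (char (gauss_smooth \<epsilon> M) t - char (gauss_smooth \<epsilon> N) t) \<le> \<bar>t\<bar> * B t"
      using le by simp
  qed (use M N \<epsilon> in \<open>auto intro: real_distribution_gauss_smooth gauss_smooth_no_atoms\<close>)
  from cdf_desmoothing[OF M N L less_imp_le[OF \<epsilon>] this, of x] show ?thesis
    by simp
qed

section \<open>Elementary estimates\<close>

lemma cdf_std_normal_Lipschitz:
  assumes "x \<le> y"
  shows "cdf std_normal_distribution y - cdf std_normal_distribution x \<le> y - x"
proof (cases "x = y")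
  case False
  interpret G: real_distribution std_normal_distribution by (rule real_dist_normal_dist)
  have le1: "std_normal_density t \<le> 1" for t
  proof -
    have "1 / sqrt (2 * pi) \<le> 1" using pi_gt3 by simp
    moreover have "exp (- t\<^sup>2 / 2) \<le> 1" by simp
    ultimately have "1 / sqrt (2 * pi) * exp (- t\<^sup>2 / 2) \<le> 1 * 1" by (intro mult_mono) auto
    then show ?thesis by (simp add: std_normal_density_def)
  qed
  have "emeasure std_normal_distribution {x<..y} = (\<integral>\<^sup>+t. ennreal (std_normal_density t) * indicator {x<..y} t \<partial>lborel)"
    by (rule emeasure_density) auto
  also have "\<dots> \<le> (\<integral>\<^sup>+t. indicator {x<..y} t \<partial>lborel)"
    by (rule nn_integral_mono) (use le1 in \<open>auto split: split_indicator\<close>)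
  also have "\<dots> = ennreal (y - x)" using assms by simp
  finally have "measure std_normal_distribution {x<..y} \<le> y - x"
    using assms by (simp add: G.emeasure_eq_measure)
  then show ?thesis using G.cdf_diff_eq[of x y] assms False by simp
qed simp

text \<open>The library bound \<open>norm_power_diff\<close> rescaled to a disc of radius r, which keeps the factor
  \<open>r ^ (n - 1)\<close> that makes the estimate integrable in t.\<close>

lemma norm_power_diff_scaled:
  fixes z w :: complex and r :: real
  assumes "r > 0" "norm z \<le> r" "norm w \<le> r"
  shows "norm (z ^ n - w ^ n) * r \<le> n * r ^ n * norm (z - w)"
proof -
  have "norm ((z / r) ^ n - (w / r) ^ n) \<le> n * norm (z / r - w / r)"
    using assms by (intro norm_power_diff) (auto simp: norm_divide)
  moreover have "(z / r) ^ n - (w / r) ^ n = (z ^ n - w ^ n) / of_real (r ^ n)"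
    by (simp add: power_divide diff_divide_distrib)
  moreover have "z / r - w / r = (z - w) / r" by (simp add: diff_divide_distrib)
  ultimately have "norm (z ^ n - w ^ n) / r ^ n \<le> n * (norm (z - w) / r)"
    using \<open>r > 0\<close> by (simp only: norm_divide norm_of_real) simp
  then show ?thesis using \<open>r > 0\<close> by (simp add: field_simps)
qed

lemma abs_exp_minus_linear_le:
  fixes x :: real
  assumes "x \<ge> 0"
  shows "\<bar>exp (- x) - (1 - x)\<bar> \<le> x\<^sup>2 / 2"
proof -
  have "1 - x \<le> exp (- x)" using exp_ge_add_one_self[of "-x"] by simp
  moreover have "exp (- x) \<le> 1 - x + x\<^sup>2 / 2"
  proof (cases "x = 0")
    case False
    then obtain t where t: "exp (-x) = (\<Sum>m<3. (-x) ^ m / fact m) + exp t / fact 3 * (-x) ^ 3" "\<bar>t\<bar> \<le> \<bar>- x\<bar>"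
      using Maclaurin_exp_le[of "-x" 3] by blast
    have "exp t / fact 3 * (-x) ^ 3 \<le> 0"
      using assms by (intro mult_nonneg_nonpos) auto
    with t(1) show ?thesis by (simp add: eval_nat_numeral)
  qed simp
  ultimately show ?thesis by linarith
qed

section \<open>Characteristic functions of normalised sums\<close>

text \<open>The Berry-Esseen setting, imposed on the law itself, so that the random variable is the
  identity.\<close>

locale std_third_moment = real_distribution M for M +
  assumes moment3: "integrable M (\<lambda>x. \<bar>x\<bar> ^ 3)"
    and mean0: "expectation (\<lambda>x. x) = 0"
    and variance1: "expectation (\<lambda>x. x\<^sup>2) = 1"
begin

definition "\<beta> = expectation (\<lambda>x. \<bar>x\<bar> ^ 3)"

lemma \<beta>_nonneg: "\<beta> \<ge> 0" by (simp add: \<beta>_def)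

lemma moments: "integrable M (\<lambda>x. x ^ 2)" "integrable M (\<lambda>x. x)"
proof -
  \<comment> \<open>A non-integrable function has integral 0 by convention, which
    \<open>variance1\<close> excludes.\<close>
  show 2: "integrable M (\<lambda>x. x ^ 2)"
  proof (rule ccontr)
    assume "\<not> ?thesis"
    then show False using variance1 by (simp add: not_integrable_integral_eq)
  qed
  then show "integrable M (\<lambda>x. x)" by (rule square_integrable_imp_integrable[rotated]) simp
qed

text \<open>The general error term is the expectation of a minimum of a quadratic and a cubic term;
  the finite third moment permits keeping the cubic one.\<close>

lemma char_quadratic: "cmod (char M t - (1 - t\<^sup>2 / 2)) \<le> \<beta> / 6 * \<bar>t\<bar> ^ 3"
proof -
  have var: "variance (\<lambda>x. x) = 1" using mean0 variance1 by simp
  have "cmod (char M t - (1 - t\<^sup>2 * 1 / 2)) \<le> t\<^sup>2 / 6 * expectation (\<lambda>x. min (6 * x\<^sup>2) (\<bar>t\<bar> * \<bar>x\<bar> ^ 3))"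
    by (rule char_approx3[OF moments(2) mean0 moments(1)]) (use var in simp)
  also have "\<dots> \<le> t\<^sup>2 / 6 * expectation (\<lambda>x. \<bar>t\<bar> * \<bar>x\<bar> ^ 3)"
    by (intro mult_left_mono integral_mono integrable_min) (use moments moment3 in auto)
  also have "\<dots> = \<beta> / 6 * \<bar>t\<bar> ^ 3"
    by (simp add: \<beta>_def power2_eq_square power3_eq_cube)
  finally show ?thesis by simp
qed

text \<open>Within this radius \<open>t\<^sup>2\<close> is at most 1 and the cubic error
  \<open>\<beta> / 6 * \<bar>t\<bar> ^ 3\<close> is at most \<open>t\<^sup>2 / 6\<close>.\<close>

definition "\<delta> = min 1 (1 / (\<beta> + 1))"

lemma \<delta>: "\<delta> > 0" "\<delta> \<le> 1" "\<delta> * \<beta> \<le> 1"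
  using \<beta>_nonneg by (auto simp: \<delta>_def field_simps min_def)

text \<open>Both bounds go through \<open>1 - t\<^sup>2 / 2\<close>. The cubic error raises the
  modulus to at most \<open>1 - t\<^sup>2 / 4\<close>, which lies below the exponential. The second
  bound holds because \<open>char M\<close> and the Gaussian each differ from the quadratic by a
  multiple of \<open>\<bar>t\<bar> ^ 3\<close>.\<close>

lemma char_near_0:
  assumes "\<bar>t\<bar> \<le> \<delta>"
  shows "cmod (char M t) \<le> exp (- t\<^sup>2 / 4)"
    and "cmod (char M t - complex_of_real (exp (- t\<^sup>2 / 2))) \<le> (\<beta> + 1) * \<bar>t\<bar> ^ 3"
proof -
  have t1: "\<bar>t\<bar> \<le> 1" and t\<beta>: "\<bar>t\<bar> * \<beta> \<le> 1"
    using assms \<delta> mult_right_mono[OF assms \<beta>_nonneg] by auto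
  have t2: "t\<^sup>2 \<le> 1" using t1 by (simp add: abs_square_le_1)
  have t3: "\<bar>t\<bar> ^ 3 = t\<^sup>2 * \<bar>t\<bar>" by (simp add: power3_eq_cube power2_eq_square)
  have "cmod (char M t) \<le> cmod (1 - t\<^sup>2 / 2) + cmod (char M t - (1 - t\<^sup>2 / 2))"
    by (metis add.commute diff_add_cancel norm_triangle_ineq)
  also have "cmod (1 - t\<^sup>2 / 2) = \<bar>1 - t\<^sup>2 / 2\<bar>"
    by (metis norm_of_real of_real_1 of_real_diff of_real_divide of_real_numeral of_real_power)
  also have "\<bar>1 - t\<^sup>2 / 2\<bar> = 1 - t\<^sup>2 / 2" using t2 by simp
  also have "1 - t\<^sup>2 / 2 + cmod (char M t - (1 - t\<^sup>2 / 2)) \<le> 1 - t\<^sup>2 / 2 + t\<^sup>2 / 4"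
  proof -
    have "\<beta> / 6 * \<bar>t\<bar> ^ 3 = t\<^sup>2 / 6 * (\<bar>t\<bar> * \<beta>)" by (simp add: t3)
    also have "\<dots> \<le> t\<^sup>2 / 6 * 1" by (rule mult_left_mono[OF t\<beta>]) simp
    finally show ?thesis using char_quadratic[of t] zero_le_power2[of t] by linarith
  qed
  also have "\<dots> \<le> exp (- t\<^sup>2 / 4)" using exp_ge_add_one_self[of "- t\<^sup>2 / 4"] by simp
  finally show "cmod (char M t) \<le> exp (- t\<^sup>2 / 4)" .
  have "cmod (complex_of_real (exp (- t\<^sup>2 / 2)) - (1 - t\<^sup>2 / 2)) = \<bar>exp (- t\<^sup>2 / 2) - (1 - t\<^sup>2 / 2)\<bar>"
    by (metis norm_of_real of_real_1 of_real_diff of_real_divide of_real_numeral of_real_power)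
  also have "\<dots> \<le> (t\<^sup>2 / 2)\<^sup>2 / 2" using abs_exp_minus_linear_le[of "t\<^sup>2 / 2"] by simp
  also have "\<dots> = \<bar>t\<bar> ^ 3 * \<bar>t\<bar> / 8"
    by (simp add: t3 power2_eq_square)
  also have "\<dots> \<le> \<bar>t\<bar> ^ 3 / 8"
    using mult_left_mono[OF t1, of "\<bar>t\<bar> ^ 3"] by simp
  finally have "cmod (complex_of_real (exp (- t\<^sup>2 / 2)) - (1 - t\<^sup>2 / 2)) \<le> \<bar>t\<bar> ^ 3 / 8" .
  with char_quadratic[of t]
  have "cmod ((char M t - (1 - t\<^sup>2 / 2)) - (complex_of_real (exp (- t\<^sup>2 / 2)) - (1 - t\<^sup>2 / 2)))
      \<le> \<beta> / 6 * \<bar>t\<bar> ^ 3 + \<bar>t\<bar> ^ 3 / 8"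
    by (intro order_trans[OF norm_triangle_ineq4]) linarith
  also have "\<dots> = (\<beta> / 6 + 1 / 8) * \<bar>t\<bar> ^ 3" by (simp add: algebra_simps)
  also have "\<dots> \<le> (\<beta> + 1) * \<bar>t\<bar> ^ 3"
    using \<beta>_nonneg by (intro mult_right_mono) auto
  finally show "cmod (char M t - complex_of_real (exp (- t\<^sup>2 / 2))) \<le> (\<beta> + 1) * \<bar>t\<bar> ^ 3" by simp
qed

text \<open>At \<open>s = t / sqrt n\<close> both bases have modulus at most \<open>r\<close>, and
  they differ by order \<open>\<bar>s\<bar> ^ 3\<close>. In the estimate for n-th powers,
  \<open>r ^ n\<close> becomes \<open>exp (- t\<^sup>2 / 4)\<close> and
  \<open>n * \<bar>s\<bar> ^ 3\<close> becomes \<open>\<bar>t\<bar> ^ 3 / sqrt n\<close>.\<close>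

lemma char_power_near_normal:
  assumes n: "n \<ge> 1" and t: "\<bar>t\<bar> \<le> \<delta> * sqrt n"
  shows "cmod (char M (t / sqrt n) ^ n - complex_of_real (exp (- t\<^sup>2 / 2)))
    \<le> 2 * (\<beta> + 1) * \<bar>t\<bar> ^ 3 / sqrt n * exp (- t\<^sup>2 / 4)"
proof -
  define s where "s = t / sqrt n"
  have sn: "sqrt n > 0" using n by simp
  have s\<delta>: "\<bar>s\<bar> \<le> \<delta>" using t sn by (simp add: s_def field_simps)
  have s2: "n * s\<^sup>2 = t\<^sup>2" using n by (simp add: s_def power_divide)
  define r where "r = exp (- s\<^sup>2 / 4)"
  have r: "r > 0" by (simp add: r_def)
  have rn: "r ^ n = exp (- t\<^sup>2 / 4)" by (simp add: r_def s2 flip: exp_of_nat_mult)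
  have "exp (- s\<^sup>2 / 2) ^ n = exp (- t\<^sup>2 / 2)" by (simp add: s2 flip: exp_of_nat_mult)
  then have en: "complex_of_real (exp (- s\<^sup>2 / 2)) ^ n = complex_of_real (exp (- t\<^sup>2 / 2))"
    by (metis of_real_power)
  have "s\<^sup>2 \<le> 1" using s\<delta> \<delta>(2) by (simp add: abs_square_le_1)
  \<comment> \<open>The power estimate carries a factor \<open>r\<close> on its left-hand side;
    removing it costs the factor 2 in the conclusion.\<close>
  then have r2: "r \<ge> 1 / 2" using exp_ge_add_one_self[of "- s\<^sup>2 / 4"] by (simp add: r_def)
  have "cmod (char M s ^ n - complex_of_real (exp (- t\<^sup>2 / 2))) * (1 / 2)
      \<le> cmod (char M s ^ n - complex_of_real (exp (- t\<^sup>2 / 2))) * r"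
    by (rule mult_left_mono[OF r2]) simp
  also have "\<dots> \<le> n * r ^ n * cmod (char M s - complex_of_real (exp (- s\<^sup>2 / 2)))"
    unfolding en[symmetric]
    by (rule norm_power_diff_scaled[OF r]) (use char_near_0(1)[OF s\<delta>] in \<open>auto simp: r_def\<close>)
  also have "\<dots> \<le> n * r ^ n * ((\<beta> + 1) * \<bar>s\<bar> ^ 3)"
    using r by (intro mult_left_mono char_near_0(2)[OF s\<delta>]) auto
  also have "n * r ^ n * ((\<beta> + 1) * \<bar>s\<bar> ^ 3) = (\<beta> + 1) * (n * \<bar>s\<bar> ^ 3) * exp (- t\<^sup>2 / 4)"
    by (simp add: rn)
  also have "n * \<bar>s\<bar> ^ 3 = \<bar>t\<bar> ^ 3 / sqrt n"
    using n by (simp add: s_def power3_eq_cube field_simps)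
  finally have "cmod (char M s ^ n - complex_of_real (exp (- t\<^sup>2 / 2))) * (1 / 2)
    \<le> (\<beta> + 1) * (\<bar>t\<bar> ^ 3 / sqrt n) * exp (- t\<^sup>2 / 4)" .
  then show ?thesis unfolding s_def by (simp add: algebra_simps)
qed

end

section \<open>Rate of convergence in the central limit theorem\<close>

text \<open>Up to the factor \<open>a / sqrt (2 * pi)\<close> the exponential is the normal density
  of standard deviation \<open>1 / a\<close>. The case \<open>k = 1\<close> serves the central range
  of the inversion integral, \<open>k = 2\<close> its tail.\<close>

lemma gaussian_even_moment:
  fixes a :: real
  assumes a: "a > 0"
  shows "has_bochner_integral lborel (\<lambda>t. t ^ (2 * k) * exp (- (a * t)\<^sup>2 / 2))
    (sqrt (2 * pi) / a ^ (2 * k + 1) * (fact (2 * k) / (2 ^ k * fact k)))"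
proof -
  have a': "1 / a > 0" using a by simp
  have "normal_density 0 (1 / a) t = a / sqrt (2 * pi) * exp (- (a * t)\<^sup>2 / 2)" for t
    using a by (simp add: normal_density_def power_divide power_mult_distrib real_sqrt_divide mult.commute)
  then have "has_bochner_integral lborel (\<lambda>t. a / sqrt (2 * pi) * exp (- (a * t)\<^sup>2 / 2) * t ^ (2 * k))
      (fact (2 * k) / ((2 * a\<^sup>2) ^ k * fact k))"
    using normal_moment_even[OF a', of 0 k] a by (simp add: power_divide)
  from has_bochner_integral_mult_right[OF this, of "sqrt (2 * pi) / a"]
  show ?thesis
    using a by (simp add: power_mult_distrib mult_ac flip: power_mult)
qed

context std_third_moment
begin

text \<open>The hypothesis on \<open>N\<close> describes the law of the normalised sum of
  \<open>n\<close> independent copies. \<open>K\<close> is chosen before \<open>n\<close>,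
  \<open>N\<close> and \<open>x\<close>, so the rate is uniform.\<close>

lemma cdf_char_power_near_normal:
  "\<exists>K. \<forall>n\<ge>1. \<forall>N. real_distribution N \<longrightarrow> (\<forall>t. char N t = char M (t / sqrt (real n)) ^ n) \<longrightarrow>
    (\<forall>x. \<bar>cdf N x - cdf std_normal_distribution x\<bar> \<le> K * real n powr (- 2 / 5))"
proof -
  define I where "I = (LINT t|lborel. t\<^sup>2 * exp (- t\<^sup>2 / 4) :: real)"
  have intI: "integrable lborel (\<lambda>t::real. t\<^sup>2 * exp (- t\<^sup>2 / 4))"
    using integrable.intros[OF gaussian_even_moment[of "1 / sqrt 2" 1]] by (simp add: power_divide)
  have I0: "I \<ge> 0" unfolding I_def by (rule Bochner_Integration.integral_nonneg) simp
  \<comment> \<open>This is \<open>sqrt n\<close> times the integral of the majorant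
    \<open>B\<close> below: the first summand comes from the central range, the second from the
    tail.\<close>
  define A where "A = 2 * (\<beta> + 1) * I + 6 * sqrt (2 * pi) / \<delta> ^ 5"
  have A0: "A \<ge> 0" using I0 \<beta>_nonneg \<delta> by (simp add: A_def)
  show ?thesis
  proof (intro exI[of _ "2 / pi * A + 8"] allI impI)
    fix n :: nat and N x
    assume n: "n \<ge> 1" and N: "real_distribution N"
      and char_N: "\<forall>t. char N t = char M (t / sqrt (real n)) ^ n"
    interpret N: real_distribution N by fact
    interpret G: real_distribution std_normal_distribution by (rule real_dist_normal_dist)
    \<comment> \<open>The exponent makes \<open>w ^ 5 * \<epsilon> ^ 5\<close> equal to
      \<open>\<delta> ^ 5 * sqrt n\<close>, so the tail is of order \<open>1 / sqrt n\<close> too,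
      while \<epsilon> still decays faster than \<open>n powr (-1/3)\<close>.\<close>
    define \<epsilon> where "\<epsilon> = real n powr (- 2 / 5)"
    have \<epsilon>: "\<epsilon> > 0" using n by (simp add: \<epsilon>_def)
    define w where "w = \<delta> * sqrt n"
    have w: "w > 0" using n \<delta> by (simp add: w_def)
    \<comment> \<open>One factor \<open>\<bar>t\<bar>\<close> is split off. The first summand is the
      central estimate; for the second, outside the central range the difference is at most 2 and
      \<open>\<bar>t\<bar> ^ 5 / w ^ 5\<close> is at least 1.\<close>
    define B where "B t = 2 * (\<beta> + 1) / sqrt n * (t\<^sup>2 * exp (- t\<^sup>2 / 4))
        + 2 / w ^ 5 * (t ^ 4 * exp (- (\<epsilon> * t)\<^sup>2 / 2))" for t
    have B12: "2 * (\<beta> + 1) / sqrt n * (t\<^sup>2 * exp (- t\<^sup>2 / 4)) \<ge> 0"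
      "2 / w ^ 5 * (t ^ 4 * exp (- (\<epsilon> * t)\<^sup>2 / 2)) \<ge> 0" for t
      using \<beta>_nonneg w by auto
    have int4: "has_bochner_integral lborel (\<lambda>t. t ^ 4 * exp (- (\<epsilon> * t)\<^sup>2 / 2)) (3 * sqrt (2 * pi) / \<epsilon> ^ 5)"
      using gaussian_even_moment[OF \<epsilon>, of 2] by (simp add: fact_numeral mult.commute)
    have intB: "integrable lborel B"
      unfolding B_def using intI integrable.intros[OF int4] by simp
    have sq: "sqrt (real n) = real n powr (1 / 2)" by (simp add: powr_half_sqrt)
    have "\<epsilon> ^ 5 = real n powr (-2)" "sqrt n ^ 5 = real n powr (5 / 2)"
      using n by (simp_all add: \<epsilon>_def sq powr_power)
    moreover have "real n powr (5 / 2) * real n powr (-2) = sqrt n"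
      unfolding sq powr_add[symmetric] by simp
    ultimately have we: "w ^ 5 * \<epsilon> ^ 5 = \<delta> ^ 5 * sqrt n"
      by (simp add: w_def power_mult_distrib)
    have "(LINT t|lborel. B t) = 2 * (\<beta> + 1) / sqrt n * I + 2 / w ^ 5 * (3 * sqrt (2 * pi) / \<epsilon> ^ 5)"
      unfolding B_def I_def using intI integrable.intros[OF int4] has_bochner_integral_integral_eq[OF int4]
      by simp
    also have "2 / w ^ 5 * (3 * sqrt (2 * pi) / \<epsilon> ^ 5) = 6 * sqrt (2 * pi) / (w ^ 5 * \<epsilon> ^ 5)" by simp
    also have "\<dots> = 6 * sqrt (2 * pi) / \<delta> ^ 5 / sqrt n" by (simp add: we)
    finally have intB_eq: "(LINT t|lborel. B t) = A / sqrt n"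
      by (simp add: A_def add_divide_distrib distrib_left distrib_right)
    have le: "cmod (char N t - char std_normal_distribution t) * exp (- (\<epsilon> * t)\<^sup>2 / 2) \<le> \<bar>t\<bar> * B t" for t
    proof (cases "\<bar>t\<bar> \<le> w")
      case True
      have "cmod (char N t - char std_normal_distribution t) * exp (- (\<epsilon> * t)\<^sup>2 / 2)
          \<le> cmod (char N t - char std_normal_distribution t) * 1"
        by (rule mult_left_mono) auto
      also have "\<dots> \<le> 2 * (\<beta> + 1) * \<bar>t\<bar> ^ 3 / sqrt n * exp (- t\<^sup>2 / 4)"
        using char_power_near_normal[OF n True[unfolded w_def]] char_N
        by (simp add: char_std_normal_distribution)
      also have "\<dots> = \<bar>t\<bar> * (2 * (\<beta> + 1) / sqrt n * (t\<^sup>2 * exp (- t\<^sup>2 / 4)))"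
        by (simp add: power3_eq_cube power2_eq_square)
      also have "\<dots> \<le> \<bar>t\<bar> * B t"
        using B12[of t] by (intro mult_left_mono) (auto simp: B_def)
      finally show ?thesis .
    next
      case False
      have "cmod (char N t - char std_normal_distribution t) \<le> 1 + 1"
        by (rule order_trans[OF norm_triangle_ineq4 add_mono[OF N.cmod_char_le_1 G.cmod_char_le_1]])
      also have "1 + 1 \<le> 2 * (\<bar>t\<bar> ^ 5 / w ^ 5)"
        using power_mono[of w "\<bar>t\<bar>" 5] False w by (simp add: pos_le_divide_eq)
      finally have "cmod (char N t - char std_normal_distribution t) * exp (- (\<epsilon> * t)\<^sup>2 / 2)
          \<le> 2 * (\<bar>t\<bar> ^ 5 / w ^ 5) * exp (- (\<epsilon> * t)\<^sup>2 / 2)"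
        by (rule mult_right_mono) simp
      also have "\<bar>t\<bar> ^ 5 = \<bar>t\<bar> * t ^ 4"
        by (simp add: eval_nat_numeral)
      also have "2 * (\<bar>t\<bar> * t ^ 4 / w ^ 5) * exp (- (\<epsilon> * t)\<^sup>2 / 2)
          = \<bar>t\<bar> * (2 / w ^ 5 * (t ^ 4 * exp (- (\<epsilon> * t)\<^sup>2 / 2)))" by simp
      also have "\<dots> \<le> \<bar>t\<bar> * B t"
        using B12[of t] by (intro mult_left_mono) (auto simp: B_def)
      finally show ?thesis .
    qed
    have "\<bar>cdf N x - cdf std_normal_distribution x\<bar> \<le> 2 / pi * (A / sqrt n) + 8 * 1 * \<epsilon>"
      unfolding intB_eq[symmetric]
      by (rule smoothing_inequality[OF N real_dist_normal_dist _ _ \<epsilon> intB _ le])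
        (use cdf_std_normal_Lipschitz B12 in \<open>auto simp: B_def intro: add_nonneg_nonneg\<close>)
    moreover have "1 / sqrt n \<le> \<epsilon>"
    proof -
      have "1 / sqrt n = real n powr (- (1 / 2))" by (simp add: sq powr_minus_divide)
      also have "\<dots> \<le> \<epsilon>" unfolding \<epsilon>_def using n by (intro powr_mono) auto
      finally show ?thesis .
    qed
    then have "2 / pi * (A / sqrt n) \<le> 2 / pi * (A * \<epsilon>)"
      using mult_left_mono[of "1 / sqrt n" \<epsilon> "2 / pi * A"] A0 by simp
    ultimately show "\<bar>cdf N x - cdf std_normal_distribution x\<bar> \<le> (2 / pi * A + 8) * real n powr (- 2 / 5)"
      by (simp add: \<epsilon>_def algebra_simps)
  qed
qed

end

text \<open>Independence and equality of laws turn the characteristic function of the normalised sum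
  into the n-th power required by \<open>cdf_char_power_near_normal\<close>.\<close>

lemma (in prob_space) clt_rate_third_moment:
  fixes Xs :: "nat \<Rightarrow> 'a \<Rightarrow> real"
  assumes \<mu>: "std_third_moment \<mu>"
    and indep: "indep_vars (\<lambda>_. borel) Xs {1..}"
    and distr: "\<And>k. k \<ge> 1 \<Longrightarrow> distr M borel (Xs k) = \<mu>"
  shows "\<exists>K. \<forall>n\<ge>1. \<forall>x. \<bar>\<P>(\<omega> in M. (\<Sum>k=1..n. Xs k \<omega>) / sqrt (real n) \<le> x)
      - cdf std_normal_distribution x\<bar> \<le> K * real n powr (- 2 / 5)"
proof -
  interpret \<mu>: std_third_moment \<mu> by fact
  obtain K where K: "\<And>n N x. n \<ge> 1 \<Longrightarrow> real_distribution N \<Longrightarrow>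
      (\<And>t. char N t = char \<mu> (t / sqrt (real n)) ^ n) \<Longrightarrow>
      \<bar>cdf N x - cdf std_normal_distribution x\<bar> \<le> K * real n powr (- 2 / 5)"
    using \<mu>.cdf_char_power_near_normal by blast
  have rv: "random_variable borel (Xs k)" if "k \<ge> 1" for k
    using indep that by (simp add: indep_vars_def2)
  show ?thesis
  proof (intro exI[of _ K] allI impI)
    fix n :: nat and x :: real assume n: "n \<ge> 1"
    let ?Y = "\<lambda>\<omega>. \<Sum>k\<in>{1..n}. Xs k \<omega> / sqrt (real n)"
    have rvY [measurable]: "random_variable borel ?Y"
    proof (rule borel_measurable_sum)
      fix k assume "k \<in> {1..n}"
      then have [measurable]: "random_variable borel (Xs k)" by (intro rv) simp
      show "random_variable borel (\<lambda>\<omega>. Xs k \<omega> / sqrt (real n))" by measurable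
    qed
    have char_k: "char (distr M borel (\<lambda>\<omega>. Xs k \<omega> / sqrt (real n))) t = char \<mu> (t / sqrt (real n))"
      if "k \<ge> 1" for k t
      using rv[OF that] unfolding char_def distr[OF that, symmetric]
      by (simp add: integral_distr)
    have "char (distr M borel ?Y) t = char \<mu> (t / sqrt (real n)) ^ n" for t
    proof -
      have "char (distr M borel ?Y) t = (\<Prod>k\<in>{1..n}. char (distr M borel (\<lambda>\<omega>. Xs k \<omega> / sqrt (real n))) t)"
        by (rule char_distr_sum, rule indep_vars_compose2[where X=Xs], rule indep_vars_subset[OF indep]) auto
      also have "\<dots> = (\<Prod>k\<in>{1..n}. char \<mu> (t / sqrt (real n)))"
        by (rule prod.cong) (auto simp: char_k)
      finally show ?thesis by simp
    qed
    from K[OF n real_distribution_distr[OF rvY] this, of x]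
    have "\<bar>cdf (distr M borel ?Y) x - cdf std_normal_distribution x\<bar> \<le> K * real n powr (- 2 / 5)" .
    moreover have "cdf (distr M borel ?Y) x = \<P>(\<omega> in M. (\<Sum>k=1..n. Xs k \<omega>) / sqrt (real n) \<le> x)"
      unfolding cdf_def
      using measure_distr[OF rvY, of "{..x}"]
      by (simp add: vimage_def Int_def conj_commute sum_divide_distrib)
    ultimately show "\<bar>\<P>(\<omega> in M. (\<Sum>k=1..n. Xs k \<omega>) / sqrt (real n) \<le> x)
      - cdf std_normal_distribution x\<bar> \<le> K * real n powr (- 2 / 5)" by simp
  qed
qed

text \<open>\<open>\<bar>x\<bar> ^ 3\<close> is at most 1 if \<open>\<bar>x\<bar> \<le> 1\<close>
  and at most \<open>x ^ 4\<close> otherwise, and constants are integrable for a probability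
  measure.\<close>

lemma std_third_moment_if_fourth:
  assumes \<mu>: "real_distribution \<mu>" and m4: "integrable \<mu> (\<lambda>x. x ^ 4)"
    and "(LINT x|\<mu>. x) = 0" "(LINT x|\<mu>. x\<^sup>2) = 1"
  shows "std_third_moment \<mu>"
proof -
  interpret real_distribution \<mu> by fact
  have "integrable \<mu> (\<lambda>x. 1 + x ^ 4)" using m4 by simp
  then have "integrable \<mu> (\<lambda>x. \<bar>x\<bar> ^ 3)"
  proof (rule Bochner_Integration.integrable_bound)
    show "AE x in \<mu>. norm (\<bar>x\<bar> ^ 3) \<le> norm (1 + x ^ 4)"
    proof (rule AE_I2)
      fix x :: real
      have "\<bar>x\<bar> ^ 3 \<le> 1 + \<bar>x\<bar> ^ 4"
      proof (cases "\<bar>x\<bar> \<le> 1")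
        case True
        then show ?thesis using power_le_one[of "\<bar>x\<bar>" 3] zero_le_power[of "\<bar>x\<bar>" 4] by linarith
      next
        case False
        then show ?thesis using power_increasing[of 3 4 "\<bar>x\<bar>"] by simp
      qed
      then show "norm (\<bar>x\<bar> ^ 3) \<le> norm (1 + x ^ 4)" by simp
    qed
  qed simp
  then show ?thesis
    using assms by unfold_locales auto
qed

section \<open>Distance between the penalised and the plain Gaussian\<close>

text \<open>Supplies the positivity of the normalising constant and of
  \<open>c\<^sub>1\<close>.\<close>

lemma integral_pos:
  fixes f :: "'a \<Rightarrow> real"
  assumes "integrable M f" "\<And>x. f x > 0" "emeasure M (space M) \<noteq> 0"
  shows "(LINT x|M. f x) > 0"
proof (rule ccontr)
  assume "\<not> (LINT x|M. f x) > 0"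
  moreover have "(LINT x|M. f x) \<ge> 0"
    using assms(2) by (intro Bochner_Integration.integral_nonneg) (auto intro: less_imp_le)
  ultimately have "(LINT x|M. f x) = 0" by linarith
  then have "AE x in M. f x = 0"
    using integral_nonneg_eq_0_iff_AE[OF assms(1)] assms(2) by (auto intro: less_imp_le)
  then have "AE x in M. \<not> True" using assms(2) by (auto simp: less_le)
  then show False using emeasure_eq_0_AE[of "\<lambda>_. True" M] assms(3) by simp
qed

text \<open>Passing from \<open>g\<close> to \<open>f\<close> removes the mass \<open>w - v\<close>,
  and normalising gives the same share back. The two effects have opposite signs, so the bound
  carries no factor 2.\<close>

lemma normalised_density_close:
  fixes f g :: "real \<Rightarrow> real"
  assumes f: "integrable lborel f" and g: "integrable lborel g"
    and f0: "\<And>x. 0 \<le> f x" and fg: "\<And>x. f x \<le> g x"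
    and v: "(LINT x|lborel. f x) > 0"
    and A [measurable]: "A \<in> sets borel"
  defines "v \<equiv> LINT x|lborel. f x" and "w \<equiv> LINT x|lborel. g x"
  shows "\<bar>(LINT x|lborel. indicator A x * f x) / v - (LINT x|lborel. indicator A x * g x) / w\<bar>
    \<le> (w - v) / w"
proof -
  define fA where "fA = (LINT x|lborel. indicator A x * f x)"
  define gA where "gA = (LINT x|lborel. indicator A x * g x)"
  have int: "integrable lborel (\<lambda>x. indicator A x * h x)" if "integrable lborel h" for h :: "real \<Rightarrow> real"
    using integrable_mult_indicator[OF _ that, of A] by simp
  have g0: "0 \<le> g x" for x using f0[of x] fg[of x] by linarith
  have v0: "v > 0" using v by (simp add: v_def)
  have vw: "v \<le> w" unfolding v_def w_def by (rule integral_mono[OF f g fg])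
  have w0: "w > 0" using v0 vw by linarith
  have "fA \<ge> 0" unfolding fA_def using f0 by (intro Bochner_Integration.integral_nonneg) simp
  have "fA \<le> v" unfolding fA_def v_def
    by (rule integral_mono[OF int[OF f] f]) (use f0 in \<open>auto split: split_indicator\<close>)
  have "fA \<le> gA" unfolding fA_def gA_def
    by (rule integral_mono[OF int[OF f] int[OF g]]) (use fg in \<open>auto split: split_indicator\<close>)
  have "gA - fA = (LINT x|lborel. indicator A x * (g x - f x))"
    unfolding fA_def gA_def right_diff_distrib
    by (rule Bochner_Integration.integral_diff[symmetric]) (use int f g in auto)
  also have "\<dots> \<le> (LINT x|lborel. g x - f x)"
    by (intro integral_mono int Bochner_Integration.integrable_diff f g)
      (use fg in \<open>auto split: split_indicator\<close>)
  also have "\<dots> = w - v" unfolding v_def w_def by (rule Bochner_Integration.integral_diff[OF g f])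
  finally have gf: "gA - fA \<le> w - v" .
  \<comment> \<open>Both terms on the right lie between 0 and \<open>(w - v) / w\<close>, hence so
    does the absolute value of their difference.\<close>
  have "fA / v - gA / w = fA / v * ((w - v) / w) - (gA - fA) / w"
    using v0 w0 by (simp add: field_simps)
  moreover have "fA / v * ((w - v) / w) \<le> 1 * ((w - v) / w)"
    using \<open>fA \<le> v\<close> v0 w0 vw by (intro mult_right_mono) auto
  moreover have "fA / v * ((w - v) / w) \<ge> 0" using \<open>fA \<ge> 0\<close> v0 w0 vw by simp
  moreover have "(gA - fA) / w \<ge> 0" using \<open>fA \<le> gA\<close> w0 by simp
  moreover have "(gA - fA) / w \<le> (w - v) / w" using gf w0 by (simp add: divide_right_mono)
  ultimately show ?thesis unfolding fA_def gA_def by linarith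
qed

lemma measure_density_lborel:
  fixes f :: "real \<Rightarrow> real"
  assumes "integrable lborel f" "\<And>x. 0 \<le> f x" and [measurable]: "A \<in> sets borel"
  shows "measure (density lborel (\<lambda>x. ennreal (f x))) A = (LINT x|lborel. indicator A x * f x)"
proof -
  have [measurable]: "f \<in> borel_measurable borel"
    using borel_measurable_integrable[OF assms(1)] by simp
  have int: "integrable lborel (\<lambda>x. indicator A x * f x)"
    using integrable_mult_indicator[OF _ assms(1), of A] by simp
  have "emeasure (density lborel (\<lambda>x. ennreal (f x))) A = (\<integral>\<^sup>+x. ennreal (f x) * indicator A x \<partial>lborel)"
    by (rule emeasure_density) auto
  also have "\<dots> = (\<integral>\<^sup>+x. ennreal (indicator A x * f x) \<partial>lborel)"
    by (rule nn_integral_cong) (auto split: split_indicator)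
  also have "\<dots> = ennreal (LINT x|lborel. indicator A x * f x)"
    by (rule nn_integral_eq_integral[OF int]) (use assms in auto)
  finally show ?thesis
    using assms(2) by (simp add: measure_def Bochner_Integration.integral_nonneg)
qed

lemma cdf_normal_scaled:
  assumes \<gamma>: "\<gamma> > 0"
  shows "cdf (density lborel (normal_density 0 \<gamma>)) x = cdf std_normal_distribution (x / \<gamma>)"
proof -
  interpret G: real_distribution std_normal_distribution by (rule real_dist_normal_dist)
  have "distributed std_normal_distribution lborel (\<lambda>x. x) (normal_density 0 1)"
    by (simp add: distributed_def distr_id2)
  from G.normal_density_affine[OF this, of \<gamma> 0] \<gamma>
  have "distr std_normal_distribution lborel (\<lambda>x. \<gamma> * x) = density lborel (normal_density 0 \<gamma>)"
    by (simp add: distributed_def)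
  then have "cdf (density lborel (normal_density 0 \<gamma>)) x = measure (distr std_normal_distribution lborel (\<lambda>x. \<gamma> * x)) {..x}"
    by (simp add: cdf_def)
  also have "\<dots> = cdf std_normal_distribution (x / \<gamma>)"
    unfolding cdf_def using \<gamma>
    by (subst measure_distr) (auto intro!: arg_cong[where f="G.prob"] simp: field_simps)
  finally show ?thesis .
qed

text \<open>The penalised density lies below the Gaussian one, and
  \<open>1 - exp (- u) \<le> u\<close> bounds the lost mass by \<open>C / (4 * \<gamma> ^ 8)\<close>
  times the fourth moment. That moment is \<open>3 * \<gamma> ^ 4\<close> times the total mass,
  which gives the relative loss on the right-hand side.\<close>

lemma cdf_penalised_gaussian:
  assumes \<gamma>: "\<gamma> > 0" and C: "C \<ge> 0"
  shows "\<bar>cdf (penalised_gaussian (Phi C) \<gamma>) x - cdf std_normal_distribution (x / \<gamma>)\<bar> \<le> 3 * C / (4 * \<gamma> ^ 4)"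
proof -
  define f where "f x = Phi C (x / \<gamma>\<^sup>2) * exp (- (x\<^sup>2 / (2 * \<gamma>\<^sup>2)))" for x
  define g where "g x = exp (- (x\<^sup>2 / (2 * \<gamma>\<^sup>2)))" for x
  have g_eq: "g x = sqrt (2 * pi) * \<gamma> * normal_density 0 \<gamma> x" for x
    using \<gamma> by (simp add: g_def normal_density_def real_sqrt_mult)
  have g4: "has_bochner_integral lborel (\<lambda>x. x ^ 4 * g x) (3 * \<gamma> ^ 4 * (sqrt (2 * pi) * \<gamma>))"
    using has_bochner_integral_mult_right[OF normal_moment_even[OF \<gamma>, of 0 2], of "sqrt (2 * pi) * \<gamma>"] \<gamma>
    by (simp add: g_eq fact_numeral power_divide mult_ac)
  have g: "integrable lborel g" unfolding g_eq using \<gamma> by auto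
  have w: "(LINT x|lborel. g x) = sqrt (2 * pi) * \<gamma>" unfolding g_eq using \<gamma> by simp
  have Phi1: "0 < Phi C y" "Phi C y \<le> 1" for y using C by (auto simp: Phi_def)
  have f0: "0 < f x" for x unfolding f_def using Phi1 by simp
  have fg: "f x \<le> g x" for x
    unfolding f_def g_def using mult_right_mono[OF Phi1(2), of "exp (- (x\<^sup>2 / (2 * \<gamma>\<^sup>2)))" "x / \<gamma>\<^sup>2"] by simp
  have [measurable]: "f \<in> borel_measurable borel" unfolding f_def Phi_def by measurable
  have f: "integrable lborel f"
    by (rule Bochner_Integration.integrable_bound[OF g]) (use f0 fg in \<open>auto intro!: AE_I2 order_trans[OF _ abs_ge_self] simp: less_imp_le\<close>)
  define v where "v = (LINT x|lborel. f x)"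
  have "v > 0" unfolding v_def by (rule integral_pos[OF f f0]) simp
  have sub: "g x - f x \<le> C / (4 * \<gamma> ^ 8) * (x ^ 4 * g x)" for x
  proof -
    have "1 - Phi C (x / \<gamma>\<^sup>2) \<le> C * (x / \<gamma>\<^sup>2) ^ 4 / 4"
      unfolding Phi_def using exp_ge_add_one_self[of "- C * (x / \<gamma>\<^sup>2) ^ 4 / 4"] by simp
    then have "(1 - Phi C (x / \<gamma>\<^sup>2)) * g x \<le> C * (x / \<gamma>\<^sup>2) ^ 4 / 4 * g x"
      by (rule mult_right_mono) (simp add: g_def)
    then show ?thesis by (simp add: f_def g_def[symmetric] power_divide algebra_simps flip: power_mult)
  qed
  have "(LINT x|lborel. g x) - v \<le> (LINT x|lborel. C / (4 * \<gamma> ^ 8) * (x ^ 4 * g x))"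
    unfolding v_def Bochner_Integration.integral_diff[OF g f, symmetric]
    by (rule integral_mono[OF _ _ sub]) (use g f integrable.intros[OF g4] in auto)
  also have "\<dots> = C / (4 * \<gamma> ^ 8) * (3 * \<gamma> ^ 4 * (sqrt (2 * pi) * \<gamma>))"
    using has_bochner_integral_integral_eq[OF g4] by simp
  also have "\<dots> = 3 * C / (4 * \<gamma> ^ 4) * (sqrt (2 * pi) * \<gamma>)"
    using \<gamma> by (simp add: field_simps eval_nat_numeral)
  finally have rel: "((LINT x|lborel. g x) - v) / (LINT x|lborel. g x) \<le> 3 * C / (4 * \<gamma> ^ 4)"
    unfolding w using \<gamma> by (simp add: pos_divide_le_eq)
  have "cdf (penalised_gaussian (Phi C) \<gamma>) x = (LINT y|lborel. indicator {..x} y * (f y / v))"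
    unfolding cdf_def penalised_gaussian_def Let_def f_def[symmetric] v_def[symmetric]
    by (rule measure_density_lborel) (use f f0 \<open>v > 0\<close> in \<open>auto intro: less_imp_le\<close>)
  then have "cdf (penalised_gaussian (Phi C) \<gamma>) x = (LINT y|lborel. indicator {..x} y * f y) / v" by simp
  moreover have "cdf std_normal_distribution (x / \<gamma>) = (LINT y|lborel. indicator {..x} y * g y) / (LINT y|lborel. g y)"
  proof -
    have "cdf std_normal_distribution (x / \<gamma>) = (LINT y|lborel. indicator {..x} y * normal_density 0 \<gamma> y)"
      unfolding cdf_normal_scaled[OF \<gamma>, symmetric] unfolding cdf_def
      by (rule measure_density_lborel) (use \<gamma> in auto)
    also have "\<dots> = (LINT y|lborel. indicator {..x} y * (g y / (sqrt (2 * pi) * \<gamma>)))"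
      unfolding g_eq using \<gamma> by (intro Bochner_Integration.integral_cong) auto
    finally show ?thesis unfolding w by simp
  qed
  ultimately show ?thesis
    using normalised_density_close[OF f g less_imp_le[OF f0] fg, of "{..x}"] \<open>v > 0\<close> rel
    unfolding v_def by simp
qed

section \<open>Comparison of \<open>Z n\<close> with \<open>H n\<close> and the remainder
  term\<close>

theorem corollary4p5:
  fixes M :: "'a measure" and X :: "'a \<Rightarrow> real" and Xs :: "nat \<Rightarrow> 'a \<Rightarrow> real"
    and N :: "nat \<Rightarrow> 'b measure" and H :: "nat \<Rightarrow> 'b \<Rightarrow> real"
    and Z :: "nat \<Rightarrow> 'a \<Rightarrow> real" and \<gamma> :: "nat \<Rightarrow> real" and C c\<^sub>1 :: real
  assumes "prob_space M"
    and "X \<in> borel_measurable M"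
    and "symmetric_rv M X"
    and "integrable M (\<lambda>\<omega>. X \<omega> ^ 4)"
    and "prob_space.expectation M X = 0"
    and "prob_space.expectation M (\<lambda>\<omega>. (X \<omega>)\<^sup>2) = 1"
    and "prob_space.expectation M (\<lambda>\<omega>. X \<omega> ^ 4) < 3"
    and "prob_space.indep_vars M (\<lambda>_. borel) Xs {1..}"
    and "\<And>k. k \<ge> 1 \<Longrightarrow> distr M borel (Xs k) = distr M borel X"
  defines "Z \<equiv> (\<lambda>n \<omega>. (\<Sum>k=1..n. Xs k \<omega>) / real n powr (1/4))"
    and "\<gamma> \<equiv> (\<lambda>n. real n powr (1/4))"
    and "C \<equiv> (3 - prob_space.expectation M (\<lambda>\<omega>. X \<omega> ^ 4)) / 6"
    and "c\<^sub>1 \<equiv> sqrt (2 * pi) *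
           prob_space.expectation std_normal_distribution (\<lambda>g. exp (- C * g ^ 4 / 4))"
  assumes "\<And>n. n \<ge> 1 \<Longrightarrow> prob_space (N n)"
    and "\<And>n. n \<ge> 1 \<Longrightarrow> H n \<in> borel_measurable (N n)"
    and "\<And>n. n \<ge> 1 \<Longrightarrow> distr (N n) borel (H n) = penalised_gaussian (Phi C) (\<gamma> n)"
  shows "\<exists>R. R \<in> O(\<lambda>n. 1 / \<gamma> n powr (8/3)) \<and>
           (\<forall>n\<ge>1. d_Kol M (Z n) (N n) (H n)
               \<le> 2 * (3 + 2 * C) powr (1/3) * (2 - 3 * C) powr (1/3)
                    / (c\<^sub>1 powr (2/3) * \<gamma> n powr (4/3)) + R n)"
proof -
  interpret prob_space M by fact
  interpret G: real_distribution std_normal_distribution by (rule real_dist_normal_dist)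
  note [measurable] = \<open>X \<in> borel_measurable M\<close>
  note law_H = \<open>\<And>n. n \<ge> 1 \<Longrightarrow> distr (N n) borel (H n) = penalised_gaussian (Phi C) (\<gamma> n)\<close>
    and rv_H = \<open>\<And>n. n \<ge> 1 \<Longrightarrow> H n \<in> borel_measurable (N n)\<close>
  have "std_third_moment (distr M borel X)"
    using assms(4-6) by (intro std_third_moment_if_fourth real_distribution_distr)
      (simp_all add: integrable_distr_eq integral_distr)
  from clt_rate_third_moment[OF this assms(8,9)] obtain K where
    K: "\<And>n x. n \<ge> 1 \<Longrightarrow> \<bar>prob {\<omega> \<in> space M. (\<Sum>k=1..n. Xs k \<omega>) / sqrt (real n) \<le> x}
        - cdf std_normal_distribution x\<bar> \<le> K * real n powr (- 2 / 5)"
    by blast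
  \<comment> \<open>The fourth moment equals \<open>3 - 6 * C\<close>. Its nonnegativity gives
    \<open>C \<le> 1 / 2\<close>, hence \<open>2 - 3 * C > 0\<close>, which the positivity of the
    main constant \<open>A\<close> needs.\<close>
  have "expectation (\<lambda>\<omega>. X \<omega> ^ 4) \<ge> 0" by (intro Bochner_Integration.integral_nonneg) simp
  moreover have "expectation (\<lambda>\<omega>. X \<omega> ^ 4) = 3 - 6 * C" by (simp add: C_def field_simps)
  ultimately have C: "C > 0" "2 - 3 * C > 0" using assms(7) by auto
  have "integrable std_normal_distribution (\<lambda>g. exp (- C * g ^ 4 / 4))"
    by (rule G.integrable_const_bound[of _ 1]) (use C in auto)
  then have c1: "c\<^sub>1 > 0"
    unfolding c\<^sub>1_def by (intro mult_pos_pos integral_pos) (use G.emeasure_space_1 in auto)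
  have \<gamma>2: "\<gamma> n * \<gamma> n = sqrt (real n)" for n
    unfolding \<gamma>_def powr_add[symmetric] by (simp add: powr_half_sqrt)
  have \<gamma>4: "\<gamma> n ^ 4 = real n" for n
    by (cases "n = 0") (simp_all add: \<gamma>_def powr_power)
  have \<gamma>43: "\<gamma> n powr (4/3) = real n powr (1/3)" for n
    by (simp add: \<gamma>_def powr_powr)
  define A where "A = 2 * (3 + 2 * C) powr (1/3) * (2 - 3 * C) powr (1/3) / c\<^sub>1 powr (2/3)"
  have A: "A > 0" unfolding A_def using C c1 by simp
  \<comment> \<open>Triangle inequality through the standard normal distribution function at
    \<open>x / \<gamma> n\<close>; this is the right point because \<open>\<gamma> n\<close> squared
    is \<open>sqrt n\<close>. The error of order 1/n from \<open>H n\<close> is absorbed in the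
    slower rate.\<close>
  have D_le: "d_Kol M (Z n) (N n) (H n) \<le> (K + C) * real n powr (- 2 / 5)" if n: "n \<ge> 1" for n
  proof -
    have \<gamma>: "\<gamma> n > 0" using n by (simp add: \<gamma>_def)
    have "d_Kol M (Z n) (N n) (H n) \<le> K * real n powr (- 2 / 5) + 3 * C / (4 * \<gamma> n ^ 4)"
      unfolding d_Kol_def
    proof (rule cSUP_least)
      fix x :: real
      have "measure (N n) {\<omega> \<in> space (N n). H n \<omega> \<le> x} = cdf (penalised_gaussian (Phi C) (\<gamma> n)) x"
        using measure_distr[OF rv_H[OF n], of "{..x}"]
        by (simp add: cdf_def law_H[OF n, symmetric] vimage_def Int_def conj_commute)
      moreover have "(Z n \<omega> \<le> x) = ((\<Sum>k=1..n. Xs k \<omega>) / sqrt (real n) \<le> x / \<gamma> n)" for \<omega>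
      proof -
        have "Z n \<omega> = (\<Sum>k=1..n. Xs k \<omega>) / \<gamma> n" by (simp add: Z_def \<gamma>_def)
        then show ?thesis
          unfolding \<gamma>2[symmetric] using \<gamma> by (simp only:) (simp add: field_simps)
      qed
      ultimately show "\<bar>prob {\<omega> \<in> space M. Z n \<omega> \<le> x} - measure (N n) {\<omega> \<in> space (N n). H n \<omega> \<le> x}\<bar>
          \<le> K * real n powr (- 2 / 5) + 3 * C / (4 * \<gamma> n ^ 4)"
        using K[OF n, of "x / \<gamma> n"] cdf_penalised_gaussian[OF \<gamma> less_imp_le[OF C(1)], of x] by simp
    qed simp
    also have "3 * C / (4 * \<gamma> n ^ 4) \<le> C * real n powr (- 1)"
      using C n by (simp add: \<gamma>4 powr_minus_divide field_simps)
    also have "C * real n powr (- 1) \<le> C * real n powr (- 2 / 5)"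
      using C n by (intro mult_left_mono powr_mono) auto
    finally show ?thesis by (simp add: algebra_simps)
  qed
  \<comment> \<open>The exponent is -2/5 + 1/3: what remains of the rate once the factor
    \<open>n powr (-1/3)\<close> of the main term is split off.\<close>
  have "\<forall>\<^sub>F n in sequentially. (K + C) * real n powr (- 1 / 15) < A"
  proof (rule order_tendstoD(2)[OF _ A])
    have "((\<lambda>n. real n powr (- 1 / 15)) \<longlongrightarrow> 0) sequentially"
      by (rule tendsto_neg_powr) (auto intro: filterlim_real_sequentially)
    then show "((\<lambda>n. (K + C) * real n powr (- 1 / 15)) \<longlongrightarrow> 0) sequentially"
      by (rule tendsto_mult_right_zero)
  qed
  then have ev: "\<forall>\<^sub>F n in sequentially. d_Kol M (Z n) (N n) (H n) \<le> A / \<gamma> n powr (4/3)"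
    using eventually_ge_at_top[of 1]
  proof eventually_elim
    case (elim n)
    have "d_Kol M (Z n) (N n) (H n) \<le> (K + C) * real n powr (- 1 / 15) * real n powr (- (1 / 3))"
      using D_le[OF elim(2)] by (simp add: mult.assoc flip: powr_add)
    also have "\<dots> \<le> A * real n powr (- (1 / 3))"
      using elim(1) by (intro mult_right_mono) auto
    finally show ?case by (simp add: \<gamma>43 powr_minus_divide)
  qed
  \<comment> \<open>The excess over the main term, cut off at 0. The inequality then holds for every
    \<open>n\<close> by construction, and a sequence that is eventually 0 lies in every
    O-class.\<close>
  define R where "R n = max 0 (d_Kol M (Z n) (N n) (H n) - A / \<gamma> n powr (4/3))" for n
  have "\<forall>\<^sub>F n in sequentially. R n = 0"
    using ev by eventually_elim (simp add: R_def)
  then have "R \<in> O(\<lambda>n. 1 / \<gamma> n powr (8/3))"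
    by (intro bigoI[of _ 1]) (auto elim: eventually_mono)
  moreover have "\<forall>n\<ge>1. d_Kol M (Z n) (N n) (H n)
      \<le> 2 * (3 + 2 * C) powr (1/3) * (2 - 3 * C) powr (1/3) / (c\<^sub>1 powr (2/3) * \<gamma> n powr (4/3)) + R n"
    by (auto simp: R_def A_def)
  ultimately show ?thesis by blast
qed

end
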